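(* For every symmetric matrix $A\in\mathbb R^{d\times d}$ define $S_\Pi(A):=\mathbb E[P_tAP_t]$ (which does not depend on $t$), and let $S_\Pi^m$ denote the $m$-fold composition of $S_\Pi$ with $S_\Pi^0=\mathrm{id}$. Under the common-solution assumption, for every $k\ge 2$, $$F^\Pi(k)=\frac1k\sum_{t=1}^{k-1}\mathbb E\,\operatorname{tr}\!\Big(S_\Pi^{k-t}(C_t)\,P_t\,S_\Pi^{t-1}(X_\star)\,P_t\Big).$$
   Context: A task is a pair $(X,y)$ with $X\in\mathbb R^{n\times d}$, $y\in\mathbb R^n$ ($n\ge1$ may depend on the task) and $\operatorname{rank}(X)<d$. $\Pi$ is a probability distribution on tasks. Common-solution assumption: there is a fixed vector $w^\star\in\mathbb R^d$ with $y=Xw^\star$ for every task under consideration. Tasks $(X_1,y_1),(X_2,y_2),\dots$ are i.i.d. from $\Pi$, with $X_t\in\mathbb R^{n_t\times d}$. Write $X^+$ for the Moore–Penrose pseudoinverse and set $$P_t:=I-X_t^+X_t,\qquad C_t:=\tfrac1{n_t}X_t^\top X_t,\qquad X_\star:=w^\star w^{\star\top};$$ $P_t$ is the orthogonal projector onto $\operatorname{null}(X_t)$. Exact-fit iterates: $w_0=0$ and, for $t\ge1$, $w_t:=\arg\min\{\tfrac12\|w-w_{t-1}\|_2^2:\ w\in\mathbb R^d,\ X_tw=y_t\}$; equivalently $w_t=w_{t-1}+X_t^+(y_t-X_tw_{t-1})=w^\star+P_t(w_{t-1}-w^\star)$. Forgetting: $\ell_t(w):=\tfrac1{n_t}\|X_tw-y_t\|_2^2$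 and $F^\Pi(k):=\mathbb E\big[\tfrac1k\sum_{t=1}^k\ell_t(w_k)\big]$. All expectations appearing are assumed finite; in particular $\mathbb E\|C_t\|_F<\infty$. *)

theory Defs
  imports "HOL-Probability.Probability"
begin

(* A pair (X, y) with X an n-by-d real matrix and y a vector in R^n, where n is data and may vary
   from task to task, is the triple (n, X, y): X i is the i-th row of X and y i the i-th entry of y,
   for i < n. Entries with i \<ge> n carry no information and are set to 0. *)
type_synonym 'd task = "nat \<times> (nat \<Rightarrow> real^'d) \<times> (nat \<Rightarrow> real)"

definition num_rows :: "'d::finite task \<Rightarrow> nat"
  where "num_rows T = fst T"

definition row_of :: "'d::finite task \<Rightarrow> nat \<Rightarrow> real^'d"
  where "row_of T = fst (snd T)"

definition resp :: "'d::finite task \<Rightarrow> nat \<Rightarrow> real"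
  where "resp T = snd (snd T)"

(* The second condition is rank X < d, with the rank taken as the dimension of the row space, as in
   the library definition of rank for matrices whose size is given by types. *)
definition is_task :: "'d::finite task \<Rightarrow> bool"
  where "is_task T \<longleftrightarrow>
    num_rows T \<ge> 1 \<and>
    dim (row_of T ` {..<num_rows T}) < CARD('d) \<and>
    (\<forall>i\<ge>num_rows T. row_of T i = 0 \<and> resp T i = 0)"

(* The product topology (nat being discrete) restricted to tasks with a given n is the Euclidean
   topology of pairs (X, y), so this is the Borel sigma-algebra of the disjoint union over n. *)
definition task_space :: "'d::finite task measure"
  where "task_space = restrict_space borel {T. is_task T}"

definition outer :: "real^'d \<Rightarrow> real^'d \<Rightarrow> real^'d::finite^'d"
  where "outer u v = (\<chi> i j. u $ i * v $ j)"

(* The d-by-d product Y X of the d-by-n matrix with columns Y 0, ..., Y (n - 1) and the n-by-d matrix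
   with rows X 0, ..., X (n - 1). In particular X^T X is cols_times_rows n X X. *)
definition cols_times_rows ::
    "nat \<Rightarrow> (nat \<Rightarrow> real^'d) \<Rightarrow> (nat \<Rightarrow> real^'d) \<Rightarrow> real^'d::finite^'d"
  where "cols_times_rows n Y X = (\<Sum>i<n. outer (Y i) (X i))"

(* The four Penrose equations, for X given by its n rows and Y by its n columns:
   X Y X = X (row by row), Y X Y = Y (column by column), (X Y)^T = X Y, (Y X)^T = Y X.
   The (i, j) entry of X Y is the inner product of X i and Y j. *)
definition is_pinv :: "nat \<Rightarrow> (nat \<Rightarrow> real^'d::finite) \<Rightarrow> (nat \<Rightarrow> real^'d) \<Rightarrow> bool"
  where "is_pinv n X Y \<longleftrightarrow>
    (\<forall>i<n. X i v* cols_times_rows n Y X = X i) \<and>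
    (\<forall>j<n. cols_times_rows n Y X *v Y j = Y j) \<and>
    (\<forall>i<n. \<forall>j<n. X i \<bullet> Y j = X j \<bullet> Y i) \<and>
    transpose (cols_times_rows n Y X) = cols_times_rows n Y X \<and>
    (\<forall>j\<ge>n. Y j = 0)"

definition pinv :: "nat \<Rightarrow> (nat \<Rightarrow> real^'d::finite) \<Rightarrow> nat \<Rightarrow> real^'d"
  where "pinv n X = (THE Y. is_pinv n X Y)"

definition null_proj :: "'d::finite task \<Rightarrow> real^'d^'d"
  where "null_proj T =
    mat 1 - cols_times_rows (num_rows T) (pinv (num_rows T) (row_of T)) (row_of T)"

(* The norm of the type real^'d^'d, used for the moment condition on this matrix, is the Frobenius norm. *)
definition task_cov :: "'d::finite task \<Rightarrow> real^'d^'d"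
  where "task_cov T = (1 / real (num_rows T)) *\<^sub>R cols_times_rows (num_rows T) (row_of T) (row_of T)"

definition fits :: "'d::finite task \<Rightarrow> real^'d \<Rightarrow> bool"
  where "fits T w \<longleftrightarrow> (\<forall>i<num_rows T. row_of T i \<bullet> w = resp T i)"

definition loss :: "'d::finite task \<Rightarrow> real^'d \<Rightarrow> real"
  where "loss T w = (1 / real (num_rows T)) * (\<Sum>i<num_rows T. (row_of T i \<bullet> w - resp T i)\<^sup>2)"

(* Tasks are numbered from 1; the entry at index 0 of the sequence is not used. *)
primrec iterate :: "(nat \<Rightarrow> 'd::finite task) \<Rightarrow> nat \<Rightarrow> real^'d"
  where
    "iterate \<tau> 0 = 0"
  | "iterate \<tau> (Suc t) = arg_min (\<lambda>w. 1/2 * (norm (w - iterate \<tau> t))\<^sup>2) (fits (\<tau> (Suc t)))"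

definition forgetting :: "'w measure \<Rightarrow> (nat \<Rightarrow> 'w \<Rightarrow> 'd::finite task) \<Rightarrow> nat \<Rightarrow> real"
  where "forgetting M T k =
    (\<integral>\<omega>. (1 / real k) * (\<Sum>t=1..k. loss (T t \<omega>) (iterate (\<lambda>s. T s \<omega>) k)) \<partial>M)"

(* Total on square matrices; of interest for symmetric A only. *)
definition S_op :: "'d::finite task measure \<Rightarrow> real^'d^'d \<Rightarrow> real^'d^'d"
  where "S_op \<mu> A = (\<integral>T. null_proj T ** A ** null_proj T \<partial>\<mu>)"

end

theory Submission
  imports Defs
begin

text \<open>
  The error $e_t = w_t - w^\star$ satisfies $e_t = P_t e_{t-1}$, so the loss of task $t$ at $w_k$ is
  $\mathrm{tr}(C_t E_k)$ with $E_k = e_k e_k^T = P_k \cdots P_1 X_\star P_1 \cdots P_k$. Integrating out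
  $P_k, \ldots, P_{t+1}$, one at a time and starting from the outside, turns $C_t$ into
  $S^{k-t}(C_t)$ by cyclicity of the trace; integrating out $P_1, \ldots, P_{t-1}$ turns $X_\star$ into
  $S^{t-1}(X_\star)$. The term $t = k$ vanishes because $C_k P_k = 0$.

  Measurability of $P_t$ and of the iterates is obtained from Gram--Schmidt recursions over the rows
  of $X_t$, which compute them by arithmetic operations only.
\<close>

section \<open>Outer products and their sums\<close>

lemma outer_mult_vec: "outer u v *v w = (v \<bullet> w) *\<^sub>R u"
  by (simp add: outer_def matrix_vector_mult_def vec_eq_iff inner_vec_def sum_distrib_right sum_distrib_left mult_ac)

lemma outer_matrix_mult: "outer u v ** A = outer u (transpose A *v v)"
  by (simp add: outer_def matrix_matrix_mult_def matrix_vector_mult_def transpose_def vec_eq_iff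
      sum_distrib_left mult_ac)

lemma matrix_mult_outer: "A ** outer u v = outer (A *v u) v"
  by (simp add: outer_def matrix_matrix_mult_def matrix_vector_mult_def vec_eq_iff
      sum_distrib_right sum_distrib_left mult_ac)

lemma transpose_outer: "transpose (outer u v) = outer v u"
  by (simp add: outer_def transpose_def vec_eq_iff mult.commute)

lemma trace_outer: "trace (outer u v) = u \<bullet> v"
  by (simp add: outer_def trace_def inner_vec_def)

lemma outer_minus_minus [simp]: "outer (- u) (- v) = outer u v"
  by (simp add: outer_def vec_eq_iff)

lemma transpose_diff: "transpose (A - B) = transpose A - transpose (B :: real^'n^'m)"
  by (simp add: transpose_def vec_eq_iff)

lemma transpose_add: "transpose (A + B) = transpose A + transpose (B :: real^'n^'m)"
  by (simp add: transpose_def vec_eq_iff)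

lemma symmetric_inner:
  fixes A :: "real^'n^'n"
  assumes "transpose A = A"
  shows "(A *v x) \<bullet> y = x \<bullet> (A *v y)"
  by (metis assms dot_lmul_matrix vector_transpose_matrix)

lemma cols_times_rows_mult_vec: "cols_times_rows n Y X *v w = (\<Sum>i<n. (X i \<bullet> w) *\<^sub>R Y i)"
  unfolding cols_times_rows_def
  by (induction n) (simp_all add: matrix_vector_mult_add_rdistrib outer_mult_vec)

lemma transpose_cols_times_rows: "transpose (cols_times_rows n Y X) = cols_times_rows n X Y"
  unfolding cols_times_rows_def
  by (induction n) (simp_all add: transpose_add transpose_outer, simp add: transpose_def vec_eq_iff)

section \<open>The projector onto the null space by Gram-Schmidt\<close>

text \<open>A row that depends on the previous ones changes nothing, because division by 0 yields 0.\<close>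

primrec null_gs :: "(nat \<Rightarrow> real^'d::finite) \<Rightarrow> nat \<Rightarrow> real^'d^'d" where
  "null_gs X 0 = mat 1"
| "null_gs X (Suc n) = null_gs X n -
     (1 / (norm (null_gs X n *v X n))\<^sup>2) *\<^sub>R outer (null_gs X n *v X n) (null_gs X n *v X n)"

lemma transpose_null_gs [simp]: "transpose (null_gs X n) = null_gs X n"
  by (induction n) (simp_all add: transpose_diff transpose_scalar transpose_outer)

lemma null_gs_inner: "(null_gs X n *v x) \<bullet> y = x \<bullet> (null_gs X n *v y)"
  by (simp add: symmetric_inner)

lemma null_gs_Suc_mult_vec:
  "null_gs X (Suc n) *v w = null_gs X n *v w -
     (((null_gs X n *v X n) \<bullet> w) / (norm (null_gs X n *v X n))\<^sup>2) *\<^sub>R (null_gs X n *v X n)"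
  by (simp add: matrix_vector_mult_diff_rdistrib scaleR_matrix_vector_assoc [symmetric] outer_mult_vec)

text \<open>Symmetry moves the projector from the new row onto \<open>w\<close>, which it fixes by
  induction; the coefficient of the rank-one correction is then
  \<open>X n \<bullet> w = 0\<close>.\<close>

lemma null_gs_fixes_null:
  assumes "\<And>i. i < n \<Longrightarrow> X i \<bullet> w = 0"
  shows "null_gs X n *v w = w"
  using assms
proof (induction n)
  case (Suc n)
  then have "null_gs X n *v w = w" by simp
  moreover from this have "(null_gs X n *v X n) \<bullet> w = 0"
    using Suc.prems by (simp add: null_gs_inner)
  ultimately show ?case by (simp only: null_gs_Suc_mult_vec) simp
qed simp

text \<open>The vector \<open>u\<close> obtained from the new row is orthogonal to all earlier rows,
  so removing its direction keeps them in the kernel. On the new row the correction is exactly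
  \<open>u\<close>, because \<open>u \<bullet> X n\<close> is the squared norm of
  \<open>u\<close>.\<close>

lemma null_gs_row [simp]: "i < n \<Longrightarrow> null_gs X n *v X i = 0"
proof (induction n arbitrary: i)
  case (Suc n)
  define u where "u = null_gs X n *v X n"
  have row: "X j \<bullet> (null_gs X n *v w) = 0" if "j < n" for j w
    using Suc.IH[OF that] by (metis null_gs_inner inner_zero_left)
  have Qu: "null_gs X n *v u = u"
    unfolding u_def by (intro null_gs_fixes_null row)
  show ?case
  proof (cases "i = n")
    case True
    have "u \<bullet> X n = (norm u)\<^sup>2"
      using Qu by (metis null_gs_inner power2_norm_eq_inner u_def)
    \<comment> \<open>For \<open>u = 0\<close> the quotient is 0 by convention, and the image of the
      row is \<open>u\<close> itself, hence already 0.\<close>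
    then show ?thesis
      unfolding True null_gs_Suc_mult_vec u_def[symmetric] by (cases "u = 0") auto
  next
    case False
    then have "i < n" using Suc.prems by simp
    then have "u \<bullet> X i = 0" using row[of i "X n"] by (simp add: u_def inner_commute)
    then show ?thesis
      unfolding null_gs_Suc_mult_vec u_def[symmetric] using Suc.IH[OF \<open>i < n\<close>] by simp
  qed
qed simp

lemma inner_null_gs [simp]: "i < n \<Longrightarrow> X i \<bullet> (null_gs X n *v w) = 0"
  by (metis null_gs_inner null_gs_row inner_zero_left)

lemma null_gs_idem_vec [simp]: "null_gs X n *v (null_gs X n *v w) = null_gs X n *v w"
  by (intro null_gs_fixes_null) simp

lemma null_gs_fixes_iff: "null_gs X n *v w = w \<longleftrightarrow> (\<forall>i<n. X i \<bullet> w = 0)"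
  by (metis inner_null_gs null_gs_fixes_null)

lemma null_gs_residual_orthogonal: "(w - null_gs X n *v w) \<bullet> (null_gs X n *v v) = 0"
  by (simp add: null_gs_inner[symmetric] matrix_vector_mult_diff_distrib)

text \<open>Pythagoras for the orthogonal splitting of \<open>w\<close> into its projection and the
  residual.\<close>

lemma norm_null_gs_le: "norm (null_gs X n *v w) \<le> norm w"
proof -
  have "(norm w)\<^sup>2 = (norm (null_gs X n *v w))\<^sup>2 + (norm (w - null_gs X n *v w))\<^sup>2"
    using null_gs_residual_orthogonal[of w X n w]
    by (simp add: power2_norm_eq_inner inner_diff_left inner_diff_right inner_commute)
  then show ?thesis
    by (smt (verit) norm_ge_zero power2_le_imp_le zero_le_power2)
qed

section \<open>The Moore-Penrose pseudoinverse\<close>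

text \<open>The pseudoinverse is $(X^T X + Q)^{-1} X^T$, where $Q$ is the projector onto the null space of
  $X$, which makes the matrix in parentheses positive definite.\<close>

lemma
  fixes X :: "nat \<Rightarrow> real^'d::finite"
  shows is_pinv_ex1: "\<exists>!Y. is_pinv n X Y" 
    and is_pinv_projector: "is_pinv n X Y \<Longrightarrow> cols_times_rows n Y X = mat 1 - null_gs X n"
proof -
  define Q where "Q = null_gs X n"
  define G where "G = cols_times_rows n X X + Q"
  have Qx: "Q *v X i = 0" if "i < n" for i using that by (simp add: Q_def)
  have Gsym: "transpose G = G" by (simp add: G_def transpose_add transpose_cols_times_rows Q_def)
  have QQ: "Q *v (Q *v w) = Q *v w" for w by (simp add: Q_def)
  have Gw: "G *v w = (\<Sum>i<n. (X i \<bullet> w) *\<^sub>R X i) + Q *v w" for w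
    by (simp add: G_def matrix_vector_mult_add_rdistrib cols_times_rows_mult_vec)
  \<comment> \<open>The quadratic form of \<open>G\<close> is |Xw|^2 + |Qw|^2. If it vanishes,
    \<open>w\<close> lies in the null space, where \<open>Q\<close> is the identity, so
    \<open>w = Q w = 0\<close>.\<close>
  have G0: "w = 0" if "G *v w = 0" for w
  proof -
    have "0 = w \<bullet> (G *v w)" using that by simp
    also have "\<dots> = (\<Sum>i<n. (X i \<bullet> w)\<^sup>2) + (norm (Q *v w))\<^sup>2"
      unfolding Gw inner_add_right inner_sum_right power2_norm_eq_inner
      using QQ by (simp add: power2_eq_square inner_commute Q_def null_gs_inner)
    finally have z: "(\<Sum>i<n. (X i \<bullet> w)\<^sup>2) = 0" "(norm (Q *v w))\<^sup>2 = 0"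
      by (smt (verit) sum_nonneg zero_le_power2)+
    from z(1) have "\<forall>i<n. X i \<bullet> w = 0" by (simp add: sum_nonneg_eq_0_iff)
    then have "Q *v w = w" unfolding Q_def by (simp add: null_gs_fixes_null)
    with z(2) show ?thesis by simp
  qed
  then obtain H where H: "H ** G = mat 1"
    by (metis matrix_left_invertible_ker)
  then have H': "G ** H = mat 1" by (simp add: matrix_left_right_inverse)
  have HG: "H *v (G *v w) = w" "G *v (H *v w) = w" for w
    using H H' by (simp_all add: matrix_vector_mul_assoc)
  have Hsym: "transpose H = H"
    by (metis Gsym H H' matrix_mul_assoc matrix_mul_lid matrix_mul_rid matrix_transpose_mul transpose_mat)
  \<comment> \<open>As \<open>X Q = 0\<close>, \<open>G\<close> is the identity on the range of
    \<open>Q\<close>, and so is its inverse \<open>H\<close>. The mirrored law \<open>QH\<close>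
    follows by symmetry.\<close>
  have HQ: "H *v (Q *v w) = Q *v w" for w
  proof -
    have "G *v (Q *v w) = Q *v w" by (simp add: Gw Q_def)
    then show ?thesis by (metis HG(1))
  qed
  have QH: "Q *v (H *v w) = Q *v w" for w
  proof -
    have "(Q *v (H *v w)) \<bullet> z = (Q *v w) \<bullet> z" for z
      by (metis HQ Hsym Q_def null_gs_inner symmetric_inner)
    then show ?thesis by (metis vector_eq_rdot)
  qed
  \<comment> \<open>Uniqueness: every pseudoinverse solves \<open>G *v Y j = X j\<close>. Symmetry
    of \<open>Y X\<close> puts \<open>Y j = Y X Y j\<close> into the row space, which
    \<open>Q\<close> kills; symmetry of \<open>X Y\<close> turns the other part of
    \<open>G *v Y j\<close> into \<open>?A *v X j\<close>, which is \<open>X j\<close>.\<close>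
  have Yeq: "Y j = (if j < n then H *v X j else 0)" if Y: "is_pinv n X Y" for Y j
  proof (cases "j < n")
    case True
    let ?A = "cols_times_rows n Y X"
    have sym: "transpose ?A = ?A" using Y by (simp add: is_pinv_def)
    have A': "?A *v w = (\<Sum>i<n. (Y i \<bullet> w) *\<^sub>R X i)" for w
      by (metis sym transpose_cols_times_rows cols_times_rows_mult_vec)
    have "Q *v (?A *v w) = 0" for w
      by (simp add: A' linear_sum matrix_vector_mul_linear Qx  matrix_vector_mult_scaleR
          linear_sum[OF matrix_vector_mul_linear])
    then have "Q *v Y j = 0" using Y True by (metis is_pinv_def)
    moreover have "(\<Sum>i<n. (X i \<bullet> Y j) *\<^sub>R X i) = (\<Sum>i<n. (Y i \<bullet> X j) *\<^sub>R X i)"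
      using Y True by (intro sum.cong) (auto simp: is_pinv_def inner_commute)
    moreover have "?A *v X j = X j"
      using Y True sym by (metis is_pinv_def vector_transpose_matrix)
    ultimately have "G *v Y j = X j" by (simp add: Gw A')
    then show ?thesis using HG True by metis
  qed (use Y in \<open>simp add: is_pinv_def\<close>)
  \<comment> \<open>Existence: the columns of \<open>H X^T\<close>. The zero branch is the padding
    demanded by \<open>is_pinv\<close>.\<close>
  define Y where "Y j = (if j < n then H *v X j else 0)" for j
  \<comment> \<open>The computation is \<open>H X^T X = H (G - Q) = I - Q\<close>.\<close>
  have proj: "cols_times_rows n Y X = mat 1 - Q"
  proof -
    have "cols_times_rows n Y X *v w = (mat 1 - Q) *v w" for w
    proof -
      have "cols_times_rows n Y X *v w = H *v (\<Sum>i<n. (X i \<bullet> w) *\<^sub>R X i)"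
        by (simp add: cols_times_rows_mult_vec Y_def linear_sum[OF matrix_vector_mul_linear]
            matrix_vector_mult_scaleR)
      also have "(\<Sum>i<n. (X i \<bullet> w) *\<^sub>R X i) = G *v w - Q *v w" by (simp add: Gw)
      finally show ?thesis
        by (simp add: matrix_vector_mult_diff_distrib matrix_vector_mult_diff_rdistrib HG HQ)
    qed
    then show ?thesis by (simp add: matrix_eq)
  qed
  have "is_pinv n X Y"
    unfolding is_pinv_def proj
  proof (intro conjI allI impI)
    fix i assume "i < n"
    have t: "transpose (mat 1 - Q) = mat 1 - Q" by (simp add: transpose_diff Q_def)
    then show "X i v* (mat 1 - Q) = X i"
      using \<open>i < n\<close> by (metis Qx diff_zero matrix_vector_mul_lid matrix_vector_mult_diff_rdistrib
          vector_transpose_matrix)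
    show "(mat 1 - Q) *v Y i = Y i"
      using \<open>i < n\<close> by (simp add: matrix_vector_mult_diff_rdistrib Y_def QH Qx)
  next
    fix i j assume "i < n" "j < n"
    then show "X i \<bullet> Y j = X j \<bullet> Y i"
      using Hsym by (simp add: Y_def) (metis inner_commute symmetric_inner)
  qed (simp_all add: transpose_diff Q_def Y_def)
  then show ex1: "\<exists>!Y. is_pinv n X Y"
    using Yeq by (metis ext)
  show "cols_times_rows n Y' X = mat 1 - null_gs X n" if "is_pinv n X Y'" for Y'
    using ex1 that \<open>is_pinv n X Y\<close> proj unfolding Q_def by metis
qed

text \<open>This trades the definite description in \<open>pinv\<close> for a recursion by
  arithmetic operations, from which the later facts about \<open>null_proj\<close> start.\<close>

lemma null_proj_eq: "null_proj T = null_gs (row_of T) (num_rows T)"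
proof -
  have "is_pinv (num_rows T) (row_of T) (pinv (num_rows T) (row_of T))"
    unfolding pinv_def by (rule theI'[OF is_pinv_ex1])
  from is_pinv_projector[OF this] show ?thesis by (simp add: null_proj_def)
qed

lemma null_proj_inner: "(null_proj T *v x) \<bullet> y = x \<bullet> (null_proj T *v y)"
  by (simp add: null_proj_eq null_gs_inner)

lemma transpose_null_proj [simp]: "transpose (null_proj T) = null_proj T"
  by (simp add: null_proj_eq)

lemma null_proj_idem_vec [simp]: "null_proj T *v (null_proj T *v x) = null_proj T *v x"
  by (simp add: null_proj_eq)

text \<open>The solution set is \<open>w\<close> plus the null space of \<open>X\<close>, and the
  projector fixes exactly that null space.\<close>

lemma null_proj_fixes_iff: "fits T w \<Longrightarrow> null_proj T *v (v - w) = v - w \<longleftrightarrow> fits T v"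
  by (auto simp: null_proj_eq null_gs_fixes_iff fits_def inner_diff_right)

section \<open>Exact-fit iterates as projections\<close>

text \<open>Adding the rows one after the other, this projects \<open>w\<close> onto the solutions of a consistent
  system.\<close>

primrec solve_rows ::
    "(nat \<Rightarrow> real^'d::finite) \<Rightarrow> (nat \<Rightarrow> real) \<Rightarrow> real^'d \<Rightarrow> nat \<Rightarrow> real^'d" where
  "solve_rows X y w 0 = w"
| "solve_rows X y w (Suc n) = solve_rows X y w n +
     ((y n - X n \<bullet> solve_rows X y w n) / (norm (null_gs X n *v X n))\<^sup>2) *\<^sub>R (null_gs X n *v X n)"

text \<open>Consistency makes the residual of the new row equal to
  \<open>- (u \<bullet> (v - w))\<close>, with \<open>u\<close> the projected row. So each step
  applies to \<open>v - w\<close> the same rank-one correction as \<open>null_gs\<close>.\<close>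

lemma solve_rows_eq:
  assumes "\<And>i. i < n \<Longrightarrow> X i \<bullet> w = y i"
  shows "solve_rows X y v n = w + null_gs X n *v (v - w)"
  using assms
proof (induction n)
  case (Suc n)
  let ?u = "null_gs X n *v X n"
  have IH: "solve_rows X y v n = w + null_gs X n *v (v - w)"
    using Suc by simp
  then have residual: "y n - X n \<bullet> solve_rows X y v n = - (?u \<bullet> (v - w))"
    using Suc.prems[of n] by (simp add: inner_add_right null_gs_inner)
  show ?case
    unfolding solve_rows.simps null_gs_Suc_mult_vec residual by (simp add: IH)
qed simp

text \<open>In contrast to \<open>w + null_proj T *v (v - w)\<close>, no solution has to be named
  here, so the expression makes sense and is measurable for inconsistent tasks too.\<close>

definition task_solve :: "'d::finite task \<Rightarrow> real^'d \<Rightarrow> real^'d"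
  where "task_solve T w = solve_rows (row_of T) (resp T) w (num_rows T)"

lemma task_solve_eq: "fits T w \<Longrightarrow> task_solve T v = w + null_proj T *v (v - w)"
  unfolding task_solve_def null_proj_eq by (rule solve_rows_eq) (simp add: fits_def)

lemma fits_task_solve: "fits T w \<Longrightarrow> fits T (task_solve T v)"
  using null_proj_fixes_iff[of T w "task_solve T v"] by (simp add: task_solve_eq)

text \<open>One Pythagorean identity serves twice: the projection \<open>p\<close> is a minimiser,
  and any other minimiser has distance 0 from \<open>p\<close>, so the choice in
  \<open>arg_min\<close> is forced.\<close>

lemma arg_min_fits:
  assumes "fits T w"
  shows "arg_min (\<lambda>x. 1/2 * (norm (x - v))\<^sup>2) (fits T) = task_solve T v"
proof -
  define p where "p = task_solve T v"
  have p: "p = w + null_proj T *v (v - w)" using task_solve_eq[OF assms] by (simp add: p_def)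
  have pyth: "(norm (x - v))\<^sup>2 = (norm (x - p))\<^sup>2 + (norm (p - v))\<^sup>2" if "fits T x" for x
  proof -
    have "x - p = null_proj T *v (x - w) - null_proj T *v (v - w)"
      using null_proj_fixes_iff[OF assms, of x] that by (simp add: p)
    then have xp: "x - p = null_proj T *v (x - v)"
      by (simp add: matrix_vector_mult_diff_distrib)
    have "null_proj T *v (p - v) = 0"
      by (simp add: p matrix_vector_mult_diff_distrib matrix_vector_right_distrib)
    \<comment> \<open>The vector \<open>x - p\<close> lies in the range of the projector and
      \<open>p - v\<close> in its kernel.\<close>
    then have "(x - p) \<bullet> (p - v) = 0"
      unfolding xp null_proj_inner by simp
    then have "orthogonal (x - p) (p - v)" by (simp add: orthogonal_def)
    from norm_add_Pythagorean[OF this] show ?thesis by simp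
  qed
  have fp: "fits T p" using fits_task_solve[OF assms] by (simp add: p_def)
  have le: "(norm (p - v))\<^sup>2 \<le> (norm (x - v))\<^sup>2" if "fits T x" for x
    unfolding pyth[OF that] by simp
  show ?thesis
    unfolding arg_min_def p_def[symmetric]
  proof (rule some_equality)
    show "is_arg_min (\<lambda>x. 1/2 * (norm (x - v))\<^sup>2) (fits T) p"
      unfolding is_arg_min_def
    proof (intro conjI notI fp)
      assume "\<exists>x. fits T x \<and> 1/2 * (norm (x - v))\<^sup>2 < 1/2 * (norm (p - v))\<^sup>2"
      then obtain x where "fits T x" "(norm (x - v))\<^sup>2 < (norm (p - v))\<^sup>2" by auto
      with le[of x] show False by linarith
    qed
  next
    fix x assume x: "is_arg_min (\<lambda>x. 1/2 * (norm (x - v))\<^sup>2) (fits T) x"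
    then have fx: "fits T x" by (simp add: is_arg_min_def)
    have "\<not> 1/2 * (norm (p - v))\<^sup>2 < 1/2 * (norm (x - v))\<^sup>2"
      using x fp unfolding is_arg_min_def by blast
    with pyth[OF fx] have "(norm (x - p))\<^sup>2 \<le> 0" by linarith
    then show "x = p" by simp
  qed
qed

text \<open>On inconsistent tasks the choice in \<open>arg_min\<close> is from the empty predicate, hence constant; this
  keeps the iterates measurable also off the event of consistency.\<close>

lemma iterate_Suc_eq:
  "iterate \<tau> (Suc t) =
    (if fits (\<tau> (Suc t)) (task_solve (\<tau> (Suc t)) 0) then task_solve (\<tau> (Suc t)) (iterate \<tau> t)
     else (SOME x. False))"
proof (cases "\<exists>w. fits (\<tau> (Suc t)) w")
  case True
  then obtain w where w: "fits (\<tau> (Suc t)) w" by blast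
  \<comment> \<open>If a solution exists, \<open>task_solve\<close> reaches one from every starting
    point, so the consistency test from 0 succeeds.\<close>
  show ?thesis
    unfolding iterate.simps arg_min_fits[OF w] using fits_task_solve[OF w] by simp
next
  case False
  then have "arg_min f (fits (\<tau> (Suc t))) = (SOME x. False)" for f :: "real^'a \<Rightarrow> real"
    unfolding arg_min_def is_arg_min_def by simp
  with False show ?thesis by (metis iterate.simps(2))
qed

section \<open>Error matrices and the loss as a trace\<close>

primrec err_mat :: "(nat \<Rightarrow> 'd::finite task) \<Rightarrow> real^'d^'d \<Rightarrow> nat \<Rightarrow> real^'d^'d" where
  "err_mat \<tau> A 0 = A"
| "err_mat \<tau> A (Suc t) = null_proj (\<tau> (Suc t)) ** err_mat \<tau> A t ** null_proj (\<tau> (Suc t))"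

text \<open>Each step multiplies the error by \<open>null_proj\<close>, and the outer product of the
  images is a sandwich by symmetry. At time 0 the error is \<open>- w\<close>, whose sign cancels in
  the outer product.\<close>

lemma outer_iterate_error:
  assumes "\<And>s. 1 \<le> s \<Longrightarrow> s \<le> k \<Longrightarrow> fits (\<tau> s) w"
  shows "outer (iterate \<tau> k - w) (iterate \<tau> k - w) = err_mat \<tau> (outer w w) k"
  using assms
proof (induction k)
  case (Suc k)
  have f: "fits (\<tau> (Suc k)) w" using Suc.prems by simp
  have "iterate \<tau> (Suc k) - w = null_proj (\<tau> (Suc k)) *v (iterate \<tau> k - w)"
    unfolding iterate.simps arg_min_fits[OF f] task_solve_eq[OF f] by simp
  then show ?case
    using Suc by (simp add: matrix_mult_outer outer_matrix_mult flip: Suc.IH)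
qed simp

lemma task_cov_mult_vec:
  "task_cov T *v v = (1 / real (num_rows T)) *\<^sub>R (\<Sum>i<num_rows T. (row_of T i \<bullet> v) *\<^sub>R row_of T i)"
  by (simp add: task_cov_def scaleR_matrix_vector_assoc[symmetric] cols_times_rows_mult_vec)

text \<open>The solution \<open>w\<close> replaces every response, so the residuals are inner
  products of rows with \<open>v - w\<close>, and their mean square is the quadratic form of
  \<open>task_cov T\<close> at \<open>v - w\<close>.\<close>

lemma loss_eq_trace:
  assumes "fits T w"
  shows "loss T v = trace (task_cov T ** outer (v - w) (v - w))"
proof -
  have "loss T v = (1 / real (num_rows T)) * (\<Sum>i<num_rows T. (row_of T i \<bullet> (v - w))\<^sup>2)"
    using assms unfolding loss_def fits_def by (simp add: inner_diff_right)
  then show ?thesis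
    by (simp add: matrix_mult_outer trace_outer task_cov_mult_vec inner_sum_left power2_eq_square)
qed

lemma task_cov_null_proj [simp]: "task_cov T ** null_proj T = 0"
  by (simp add: matrix_eq matrix_vector_mul_assoc[symmetric] task_cov_mult_vec null_proj_eq)

section \<open>Uniform bounds and continuity\<close>

text \<open>By symmetry row \<open>i\<close> is the image of the \<open>i\<close>-th basis vector,
  of norm at most 1. The bound is crude but the same for all tasks, as the domination arguments
  require.\<close>

lemma norm_null_proj_le: "norm (null_proj (T :: 'd::finite task)) \<le> real CARD('d)"
proof -
  have "norm (null_proj T $ i) \<le> 1" for i
  proof -
    have "null_proj T $ i = column i (transpose (null_proj T))"
      by (simp add: column_def transpose_def vec_eq_iff)
    also have "\<dots> = null_proj T *v axis i 1" by (simp add: matrix_vector_mult_basis)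
    finally show ?thesis
      using norm_null_gs_le[of "row_of T" "num_rows T" "axis i 1"] by (simp add: null_proj_eq norm_axis_1)
  qed
  then have "(\<Sum>i\<in>UNIV. norm (null_proj T $ i)) \<le> real CARD('d)"
    using sum_bounded_above[of UNIV "\<lambda>i. norm (null_proj T $ i)" 1] by simp
  then show ?thesis
    using L2_set_le_sum[of UNIV "\<lambda>i. norm (null_proj T $ i)"] norm_vec_def[of "null_proj T"] by simp
qed

lemma bounded_bilinear_matrix_mult:
  "bounded_bilinear ((**) :: real^'n^'m \<Rightarrow> real^'p^'n \<Rightarrow> real^'p^'m)"
  unfolding bilinear_conv_bounded_bilinear[symmetric] bilinear_def
  by (auto intro!: linearI simp: matrix_matrix_mult_def vec_eq_iff
      sum.distrib sum_distrib_left algebra_simps)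

lemma bounded_bilinear_matrix_vec_mult:
  "bounded_bilinear ((*v) :: real^'n^'m \<Rightarrow> real^'n \<Rightarrow> real^'m)"
  unfolding bilinear_conv_bounded_bilinear[symmetric] bilinear_def
  by (auto intro!: linearI simp: matrix_vector_mult_def vec_eq_iff
      sum.distrib sum_distrib_left algebra_simps)

lemma bounded_bilinear_outer: "bounded_bilinear (outer :: real^'d \<Rightarrow> real^'d \<Rightarrow> real^'d^'d)"
  unfolding bilinear_conv_bounded_bilinear[symmetric] bilinear_def
  by (auto intro!: linearI simp: outer_def vec_eq_iff algebra_simps)

lemma bounded_linear_trace: "bounded_linear (trace :: real^'n^'n \<Rightarrow> real)"
  unfolding linear_conv_bounded_linear[symmetric]
  by (auto intro!: linearI simp: trace_def sum.distrib sum_distrib_left)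

section \<open>Measurability\<close>

lemma borel_measurable_bounded_bilinear:
  fixes f :: "'a \<Rightarrow> 'b::{real_normed_vector, second_countable_topology}"
    and g :: "'a \<Rightarrow> 'c::{real_normed_vector, second_countable_topology}"
  assumes "bounded_bilinear h" and "f \<in> borel_measurable M" "g \<in> borel_measurable M"
  shows "(\<lambda>x. h (f x) (g x)) \<in> borel_measurable M"
  by (rule borel_measurable_continuous_Pair[OF assms(2,3)])
    (rule bounded_bilinear.continuous_on[OF assms(1)], (intro continuous_intros)+)

lemmas borel_measurable_matrix_mult [measurable] =
  borel_measurable_bounded_bilinear[OF bounded_bilinear_matrix_mult]
lemmas borel_measurable_matrix_vec_mult [measurable] =
  borel_measurable_bounded_bilinear[OF bounded_bilinear_matrix_vec_mult]
lemmas borel_measurable_outer [measurable] =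
  borel_measurable_bounded_bilinear[OF bounded_bilinear_outer]

lemma borel_measurable_trace [measurable]:
  fixes f :: "'a \<Rightarrow> real^'n^'n"
  shows "f \<in> borel_measurable M \<Longrightarrow> (\<lambda>x. trace (f x)) \<in> borel_measurable M"
  by (rule measurable_compose[OF _ borel_measurable_continuous_onI])
    (auto intro: linear_continuous_on bounded_linear_trace)

lemma measurable_num_rows [measurable]: "num_rows \<in> task_space \<rightarrow>\<^sub>M count_space UNIV"
proof -
  have "num_rows \<in> borel \<rightarrow>\<^sub>M (borel :: nat measure)"
    unfolding num_rows_def by (intro borel_measurable_continuous_onI continuous_intros)
  then have "num_rows \<in> borel \<rightarrow>\<^sub>M (count_space UNIV :: nat measure)"
    using measurable_cong_sets[OF refl sets_borel_eq_count_space] by blast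
  then show ?thesis unfolding task_space_def by (rule measurable_restrict_space1)
qed

lemma measurable_row_of [measurable]: "(\<lambda>T. row_of T i) \<in> borel_measurable task_space"
proof -
  have "(\<lambda>T :: 'a task. fst (snd T)) \<in> borel_measurable borel"
    by (intro borel_measurable_continuous_onI continuous_intros)
  moreover have "(\<lambda>f :: nat \<Rightarrow> real^'a. f i) \<in> borel_measurable borel"
    by (intro borel_measurable_continuous_onI continuous_on_product_coordinates)
  ultimately have "(\<lambda>T :: 'a task. fst (snd T) i) \<in> borel_measurable borel"
    by (rule measurable_compose)
  then show ?thesis unfolding row_of_def task_space_def by (rule measurable_restrict_space1)
qed

lemma measurable_resp [measurable]: "(\<lambda>T. resp T i) \<in> borel_measurable task_space"
proof -
  have "(\<lambda>T :: 'a task. snd (snd T)) \<in> borel_measurable borel"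
    by (intro borel_measurable_continuous_onI continuous_intros)
  moreover have "(\<lambda>f :: nat \<Rightarrow> real. f i) \<in> borel_measurable borel"
    by (intro borel_measurable_continuous_onI continuous_on_product_coordinates)
  ultimately have "(\<lambda>T :: 'a task. snd (snd T) i) \<in> borel_measurable borel"
    by (rule measurable_compose)
  then show ?thesis unfolding resp_def task_space_def by (rule measurable_restrict_space1)
qed

lemma measurable_null_gs [measurable]: "(\<lambda>T. null_gs (row_of T) n) \<in> borel_measurable task_space"
  by (induction n) auto

text \<open>The recursion depth varies with the task. It is frozen first, and the countably many
  values of \<open>num_rows\<close> are then put together; losses and solutions are treated
  likewise.\<close>

lemma measurable_null_proj [measurable]: "null_proj \<in> borel_measurable task_space"
  unfolding null_proj_eq[abs_def] by (rule measurable_compose_countable[OF measurable_null_gs]) measurable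

lemma measurable_task_cov [measurable]: "task_cov \<in> borel_measurable task_space"
proof -
  have "(\<lambda>T. (1 / real n) *\<^sub>R cols_times_rows n (row_of T) (row_of T)) \<in> borel_measurable task_space" for n
    unfolding cols_times_rows_def by measurable
  from measurable_compose_countable[OF this measurable_num_rows] 
  show ?thesis unfolding task_cov_def .
qed

lemma measurable_fits:
  assumes [measurable]: "\<tau> \<in> N \<rightarrow>\<^sub>M task_space" "v \<in> borel_measurable N"
  shows "Measurable.pred N (\<lambda>x. fits (\<tau> x) (v x))"
  unfolding fits_def by measurable

lemma measurable_loss:
  assumes [measurable]: "\<tau> \<in> N \<rightarrow>\<^sub>M task_space" "v \<in> borel_measurable N"
  shows "(\<lambda>x. loss (\<tau> x) (v x)) \<in> borel_measurable N"
proof -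
  have "(\<lambda>x. (1 / real n) * (\<Sum>i<n. (row_of (\<tau> x) i \<bullet> v x - resp (\<tau> x) i)\<^sup>2)) \<in> borel_measurable N" for n
    by measurable
  from measurable_compose_countable[OF this measurable_compose[OF assms(1) measurable_num_rows]]
  show ?thesis unfolding loss_def .
qed

lemma measurable_task_solve:
  assumes [measurable]: "\<tau> \<in> N \<rightarrow>\<^sub>M task_space" "v \<in> borel_measurable N"
  shows "(\<lambda>x. task_solve (\<tau> x) (v x)) \<in> borel_measurable N"
proof -
  have "(\<lambda>x. solve_rows (row_of (\<tau> x)) (resp (\<tau> x)) (v x) n) \<in> borel_measurable N" for n
    by (induction n) auto
  from measurable_compose_countable[OF this measurable_compose[OF assms(1) measurable_num_rows]]
  show ?thesis unfolding task_solve_def .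
qed

text \<open>By \<open>iterate_Suc_eq\<close>, \<open>arg_min\<close> becomes a case distinction on a
  measurable event between arithmetic and a constant.\<close>

lemma measurable_iterate:
  assumes "\<And>s. 1 \<le> s \<Longrightarrow> s \<le> k \<Longrightarrow> \<tau> s \<in> N \<rightarrow>\<^sub>M task_space"
  shows "(\<lambda>x. iterate (\<lambda>s. \<tau> s x) k) \<in> borel_measurable N"
  using assms
proof (induction k)
  case (Suc k)
  then have [measurable]: "\<tau> (Suc k) \<in> N \<rightarrow>\<^sub>M task_space"
    "(\<lambda>x. iterate (\<lambda>s. \<tau> s x) k) \<in> borel_measurable N" by simp_all
  note [measurable] = measurable_fits measurable_task_solve
  show ?case unfolding iterate_Suc_eq by measurable
qed simp

lemma measurable_err_mat:
  assumes "\<And>s. 1 \<le> s \<Longrightarrow> s \<le> k \<Longrightarrow> \<tau> s \<in> N \<rightarrow>\<^sub>M task_space"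
  shows "(\<lambda>x. err_mat (\<lambda>s. \<tau> s x) A k) \<in> borel_measurable N"
  using assms
proof (induction k)
  case (Suc k)
  then have [measurable]: "\<tau> (Suc k) \<in> N \<rightarrow>\<^sub>M task_space"
    "(\<lambda>x. err_mat (\<lambda>s. \<tau> s x) A k) \<in> borel_measurable N" by simp_all
  show ?case by simp
qed simp

text \<open>This allows the task sequence to be replaced by its restriction to
  \<open>{1..k}\<close>, a point of the product space.\<close>

lemma err_mat_cong:
  assumes "\<And>s. 1 \<le> s \<Longrightarrow> s \<le> k \<Longrightarrow> \<sigma> s = \<tau> s"
  shows "err_mat \<sigma> A k = err_mat \<tau> A k"
  using assms by (induction k) simp_all

section \<open>Integrability and linearity of the averaging operator\<close>

lemma bounded_linear_sandwich: "bounded_linear (\<lambda>A. B ** A ** (C :: real^'d^'d))"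
  using bounded_linear_compose[OF
      bounded_bilinear.bounded_linear_left[OF bounded_bilinear_matrix_mult]
      bounded_bilinear.bounded_linear_right[OF bounded_bilinear_matrix_mult]] .

lemma sandwich_null_proj_bound:
  obtains K where "K \<ge> 0"
    "\<And>(T :: 'd::finite task) A. norm (null_proj T ** A ** null_proj T) \<le> K * norm A"
proof -
  obtain C where C: "C \<ge> 0" "\<And>(A :: real^'d^'d) (B :: real^'d^'d). norm (A ** B) \<le> norm A * norm B * C"
    using bounded_bilinear.nonneg_bounded[OF bounded_bilinear_matrix_mult] by metis
  have "norm (null_proj T ** A ** null_proj T) \<le> (real CARD('d) * C)\<^sup>2 * norm A"
    for T :: "'d task" and A
  proof -
    have "norm (null_proj T ** A ** null_proj T) \<le> norm (null_proj T ** A) * norm (null_proj T) * C"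
      by (rule C)
    also have "\<dots> \<le> (norm (null_proj T) * norm A * C) * norm (null_proj T) * C"
      using C by (intro mult_right_mono) auto
    also have "\<dots> = (norm (null_proj T))\<^sup>2 * (C\<^sup>2 * norm A)"
      by (simp add: power2_eq_square)
    also have "\<dots> \<le> (real CARD('d))\<^sup>2 * (C\<^sup>2 * norm A)"
      by (intro mult_right_mono power_mono norm_null_proj_le) auto
    finally show ?thesis by (simp add: power_mult_distrib)
  qed
  then show ?thesis using that[of "(real CARD('d) * C)\<^sup>2"] by simp
qed

text \<open>The constant may depend on \<open>A\<close> and \<open>k\<close> but not on the tasks,
  so random error matrices are bounded.\<close>

lemma err_mat_bound: "\<exists>K. \<forall>\<tau> :: nat \<Rightarrow> 'd::finite task. norm (err_mat \<tau> A k) \<le> K"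
proof (induction k)
  case (Suc k)
  then obtain K where K: "norm (err_mat \<tau> A k) \<le> K" for \<tau> :: "nat \<Rightarrow> 'd task" by blast
  obtain L where L: "L \<ge> 0" "\<And>(T :: 'd task) A. norm (null_proj T ** A ** null_proj T) \<le> L * norm A"
    using sandwich_null_proj_bound by blast
  have "norm (err_mat \<tau> A (Suc k)) \<le> L * K" for \<tau> :: "nat \<Rightarrow> 'd task"
    using L(2)[of "\<tau> (Suc k)" "err_mat \<tau> A k"] mult_left_mono[OF K L(1)]
    by (simp del: err_mat.simps(1)) (meson order_trans)
  then show ?case by blast
qed auto

lemma integrable_sandwich_null_proj:
  fixes B :: "'a \<Rightarrow> real^'d::finite^'d"
  assumes [measurable]: "\<tau> \<in> N \<rightarrow>\<^sub>M task_space" and B: "integrable N B"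
  shows "integrable N (\<lambda>x. null_proj (\<tau> x) ** B x ** null_proj (\<tau> x))"
proof -
  obtain K where K: "K \<ge> 0" "\<And>(T :: 'd task) A. norm (null_proj T ** A ** null_proj T) \<le> K * norm A"
    using sandwich_null_proj_bound by blast
  have [measurable]: "B \<in> borel_measurable N" using B by simp
  show ?thesis
  proof (rule Bochner_Integration.integrable_bound)
    show "integrable N (\<lambda>x. K * norm (B x))" using B by simp
    show "AE x in N. norm (null_proj (\<tau> x) ** B x ** null_proj (\<tau> x)) \<le> norm (K * norm (B x))"
      using K by (auto simp: abs_mult)
  qed measurable
qed

text \<open>Intended for \<open>B\<close> built from \<open>task_cov\<close>, which is merely
  integrable, and for \<open>U\<close> an error matrix, which is bounded.\<close>

lemma integrable_trace_mult_bounded: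
  fixes B U :: "'a \<Rightarrow> real^'d::finite^'d"
  assumes B: "integrable N B" and [measurable]: "U \<in> borel_measurable N"
    and U: "\<And>x. norm (U x) \<le> K"
  shows "integrable N (\<lambda>x. trace (B x ** U x))"
proof -
  obtain C where C: "C \<ge> 0" "\<And>(A :: real^'d^'d) (B :: real^'d^'d). norm (A ** B) \<le> norm A * norm B * C"
    using bounded_bilinear.nonneg_bounded[OF bounded_bilinear_matrix_mult] by metis
  have [measurable]: "B \<in> borel_measurable N" using B by simp
  have "integrable N (\<lambda>x. B x ** U x)"
  proof (rule Bochner_Integration.integrable_bound)
    show "integrable N (\<lambda>x. (K * C) * norm (B x))" using B by simp
    have "norm (B x ** U x) \<le> norm ((K * C) * norm (B x))" for x
    proof -
      have "norm (B x ** U x) \<le> norm (B x) * norm (U x) * C" by (rule C)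
      also have "\<dots> \<le> norm (B x) * K * C"
        using C U by (intro mult_right_mono mult_left_mono) auto
      also have "\<dots> \<le> norm ((K * C) * norm (B x))" by (simp add: mult_ac)
      finally show ?thesis .
    qed
    then show "AE x in N. norm (B x ** U x) \<le> norm ((K * C) * norm (B x))" by simp
  qed measurable
  then show ?thesis by (rule integrable_bounded_linear[OF bounded_linear_trace])
qed

text \<open>The integrals exist because projectors are uniformly bounded, and in finite dimension
  linearity gives boundedness. Hence powers of \<open>S_op\<close> preserve the integrability of
  \<open>task_cov\<close>.\<close>

lemma bounded_linear_S_op:
  fixes \<mu> :: "'d::finite task measure"
  assumes "prob_space \<mu>" and sets: "sets \<mu> = sets task_space"
  shows "bounded_linear (S_op \<mu>)"
proof -
  interpret prob_space \<mu> by fact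
  have id: "(\<lambda>T. T) \<in> \<mu> \<rightarrow>\<^sub>M task_space"
    by (simp add: measurable_cong_sets[OF sets refl])
  have int: "integrable \<mu> (\<lambda>T. null_proj T ** A ** null_proj T)" for A :: "real^'d^'d"
    using integrable_sandwich_null_proj[OF id, of "\<lambda>_. A"] by simp
  have "linear (S_op \<mu>)"
  proof (rule linearI)
    show "S_op \<mu> (A + B) = S_op \<mu> A + S_op \<mu> B" for A B
      unfolding S_op_def bounded_linear.linear[OF bounded_linear_sandwich, THEN linear_add]
      by (rule Bochner_Integration.integral_add[OF int int])
    show "S_op \<mu> (r *\<^sub>R A) = r *\<^sub>R S_op \<mu> A" for r A
      unfolding S_op_def bounded_linear.linear[OF bounded_linear_sandwich, THEN linear_scale]
      by simp
  qed
  then show ?thesis by (simp add: linear_conv_bounded_linear)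
qed

section \<open>Independent tasks and Fubini\<close>

locale iid_tasks = prob_space M for M :: "'w measure" +
  fixes \<mu> :: "'d::finite task measure" and T :: "nat \<Rightarrow> 'w \<Rightarrow> 'd task"
  assumes indep_T: "indep_vars (\<lambda>_. task_space) T {1..}"
    and distr_T: "\<And>t. t \<ge> 1 \<Longrightarrow> distr M task_space (T t) = \<mu>"
    and integrable_cov: "integrable \<mu> task_cov"
begin

lemma measurable_T: "t \<ge> 1 \<Longrightarrow> T t \<in> M \<rightarrow>\<^sub>M task_space"
  using indep_T by (simp add: indep_vars_def)

lemma sets_mu [measurable_cong]: "sets \<mu> = sets task_space"
  using distr_T[of 1] by (metis order_refl sets_distr)

lemma prob_space_mu: "prob_space \<mu>"
  using distr_T[of 1] prob_space_distr[OF measurable_T, of 1] by simp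

lemma integral_T:
  fixes f :: "'d task \<Rightarrow> 'b::{banach, second_countable_topology}"
  assumes "t \<ge> 1" "f \<in> borel_measurable task_space"
  shows "(\<integral>\<omega>. f (T t \<omega>) \<partial>M) = (\<integral>\<tau>. f \<tau> \<partial>\<mu>)"
  using integral_distr[OF measurable_T assms(2)] distr_T assms(1) by metis

lemma integrable_T:
  fixes f :: "'d task \<Rightarrow> 'b::{banach, second_countable_topology}"
  assumes "t \<ge> 1" "integrable \<mu> f"
  shows "integrable M (\<lambda>\<omega>. f (T t \<omega>))"
  using integrable_distr[OF measurable_T, of t f] distr_T assms by simp

lemma S_op_eq: "t \<ge> 1 \<Longrightarrow> (\<integral>\<omega>. null_proj (T t \<omega>) ** A ** null_proj (T t \<omega>) \<partial>M) = S_op \<mu> A"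
  unfolding S_op_def by (rule integral_T) measurable

lemma bounded_linear_S_op_power: "bounded_linear (S_op \<mu> ^^ i)"
proof (induction i)
  case (Suc i)
  then show ?case
    using bounded_linear_compose[OF bounded_linear_S_op[OF prob_space_mu sets_mu]] by (simp add: comp_def)
qed (simp add: bounded_linear_ident id_def)

text \<open>By independence, the joint law of the first \<open>j\<close> tasks and the next one is
  the product of the law of the past and \<open>\<mu>\<close>; the two claims are the two orders of
  Fubini. The first averages the new task with the past frozen, the second the past with the new
  task frozen.\<close>

lemma integral_past_next:
  fixes f :: "(nat \<Rightarrow> 'd task) \<Rightarrow> 'd task \<Rightarrow> 'b::{banach, second_countable_topology}"
  defines "past \<equiv> \<lambda>j \<omega>. \<lambda>s\<in>{1..j}. T s \<omega>"
  assumes f: "case_prod f \<in> borel_measurable (PiM {1..j} (\<lambda>_. task_space) \<Otimes>\<^sub>M task_space)"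
    and int: "integrable M (\<lambda>\<omega>. f (past j \<omega>) (T (Suc j) \<omega>))"
  shows "(\<integral>\<omega>. f (past j \<omega>) (T (Suc j) \<omega>) \<partial>M) = (\<integral>\<omega>. (\<integral>\<tau>. f (past j \<omega>) \<tau> \<partial>\<mu>) \<partial>M)"
    and "(\<integral>\<omega>. f (past j \<omega>) (T (Suc j) \<omega>) \<partial>M) = (\<integral>\<tau>. (\<integral>\<omega>. f (past j \<omega>) \<tau> \<partial>M) \<partial>\<mu>)"
proof -
  let ?N = "PiM {1..j} (\<lambda>_. task_space :: 'd task measure)"
  let ?N' = "PiM {Suc j} (\<lambda>_. task_space :: 'd task measure)"
  let ?next = "\<lambda>\<omega>. \<lambda>s\<in>{Suc j}. T s \<omega>"
  \<comment> \<open>The disjoint index blocks \<open>{1..j}\<close> and \<open>{Suc j}\<close> give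
    independent restrictions. The second is a function on a singleton, unwrapped below by evaluation
    at \<open>Suc j\<close>.\<close>
  have "indep_var ?N (past j) ?N' ?next"
    unfolding past_def by (rule indep_var_restrict[OF indep_T]) auto
  then have past [measurable]: "past j \<in> M \<rightarrow>\<^sub>M ?N" and [measurable]: "?next \<in> M \<rightarrow>\<^sub>M ?N'"
    and joint: "distr M ?N (past j) \<Otimes>\<^sub>M distr M ?N' ?next = distr M (?N \<Otimes>\<^sub>M ?N') (\<lambda>\<omega>. (past j \<omega>, ?next \<omega>))"
    by (auto simp: indep_var_distribution_eq)
  have joint_measurable: "(\<lambda>\<omega>. (past j \<omega>, ?next \<omega>)) \<in> M \<rightarrow>\<^sub>M ?N \<Otimes>\<^sub>M ?N'"
    by measurable
  have [measurable]: "(\<lambda>z. z (Suc j)) \<in> ?N' \<rightarrow>\<^sub>M (task_space :: 'd task measure)"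
    by (rule measurable_component_singleton) simp
  have mu: "distr (distr M ?N' ?next) task_space (\<lambda>z. z (Suc j)) = \<mu>"
    using distr_T[of "Suc j"] by (simp add: distr_distr comp_def)
  have prod: "distr M ?N (past j) \<Otimes>\<^sub>M \<mu> = distr M (?N \<Otimes>\<^sub>M task_space) (\<lambda>\<omega>. (past j \<omega>, T (Suc j) \<omega>))"
  proof -
    have "distr M ?N (past j) \<Otimes>\<^sub>M \<mu> =
        distr (distr M ?N (past j)) ?N (\<lambda>x. x) \<Otimes>\<^sub>M distr (distr M ?N' ?next) task_space (\<lambda>z. z (Suc j))"
      unfolding mu by (subst distr_id2) simp_all
    also have "\<dots> = distr (distr M ?N (past j) \<Otimes>\<^sub>M distr M ?N' ?next) (?N \<Otimes>\<^sub>M task_space)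
        (\<lambda>(x, z). (x, z (Suc j)))"
      by (rule pair_measure_distr)
        (use prob_space_mu in \<open>simp_all add: mu prob_space_imp_sigma_finite\<close>)
    also have "\<dots> = distr M (?N \<Otimes>\<^sub>M task_space) (\<lambda>\<omega>. (past j \<omega>, T (Suc j) \<omega>))"
      unfolding joint by (subst distr_distr[OF _ joint_measurable]) (measurable, simp add: comp_def)
    finally show ?thesis .
  qed
  have [measurable]: "T (Suc j) \<in> M \<rightarrow>\<^sub>M task_space" by (simp add: measurable_T)
  have pair: "(\<lambda>\<omega>. (past j \<omega>, T (Suc j) \<omega>)) \<in> M \<rightarrow>\<^sub>M ?N \<Otimes>\<^sub>M task_space" by measurable
  interpret P: prob_space "distr M ?N (past j)" by (rule prob_space_distr) measurable
  interpret Q: prob_space \<mu> by (rule prob_space_mu)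
  interpret pair_sigma_finite "distr M ?N (past j)" \<mu> ..
  have int': "integrable (distr M ?N (past j) \<Otimes>\<^sub>M \<mu>) (case_prod f)"
    unfolding prod using int by (subst integrable_distr_eq[OF pair f]) simp
  have eq: "(\<integral>\<omega>. f (past j \<omega>) (T (Suc j) \<omega>) \<partial>M) = integral\<^sup>L (distr M ?N (past j) \<Otimes>\<^sub>M \<mu>) (case_prod f)"
    unfolding prod by (subst integral_distr[OF pair f]) simp
  have fmu: "case_prod f \<in> borel_measurable (?N \<Otimes>\<^sub>M \<mu>)"
    using f by (simp add: measurable_cong_sets[OF sets_pair_measure_cong[OF refl sets_mu] refl])
  have "(\<integral>\<omega>. f (past j \<omega>) (T (Suc j) \<omega>) \<partial>M) = (\<integral>x. (\<integral>\<tau>. f x \<tau> \<partial>\<mu>) \<partial>distr M ?N (past j))"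
    unfolding eq integral_fst[OF int'] ..
  also have "\<dots> = (\<integral>\<omega>. (\<integral>\<tau>. f (past j \<omega>) \<tau> \<partial>\<mu>) \<partial>M)"
    by (rule integral_distr[OF past Q.borel_measurable_lebesgue_integral[OF fmu]])
  finally show "(\<integral>\<omega>. f (past j \<omega>) (T (Suc j) \<omega>) \<partial>M) = (\<integral>\<omega>. (\<integral>\<tau>. f (past j \<omega>) \<tau> \<partial>\<mu>) \<partial>M)" .
  have "(\<integral>\<omega>. f (past j \<omega>) (T (Suc j) \<omega>) \<partial>M) = (\<integral>\<tau>. (\<integral>x. f x \<tau> \<partial>distr M ?N (past j)) \<partial>\<mu>)"
    unfolding eq integral_snd[OF int'] ..
  also have "\<dots> = (\<integral>\<tau>. (\<integral>\<omega>. f (past j \<omega>) \<tau> \<partial>M) \<partial>\<mu>)"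
  proof (rule Bochner_Integration.integral_cong[OF refl])
    fix \<tau> assume "\<tau> \<in> space \<mu>"
    then have "\<tau> \<in> space task_space" by (simp add: sets_eq_imp_space_eq[OF sets_mu])
    then have "(\<lambda>x. f x \<tau>) \<in> borel_measurable ?N"
      using measurable_compose[OF measurable_Pair2' f] by simp
    then show "(\<integral>x. f x \<tau> \<partial>distr M ?N (past j)) = (\<integral>\<omega>. f (past j \<omega>) \<tau> \<partial>M)"
      by (rule integral_distr[OF past])
  qed
  finally show "(\<integral>\<omega>. f (past j \<omega>) (T (Suc j) \<omega>) \<partial>M) = (\<integral>\<tau>. (\<integral>\<omega>. f (past j \<omega>) \<tau> \<partial>M) \<partial>\<mu>)" .
qed

section \<open>Integrating out the projectors\<close>

definition err :: "real^'d^'d \<Rightarrow> nat \<Rightarrow> 'w \<Rightarrow> real^'d^'d"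
  where "err A k \<omega> = err_mat (\<lambda>s. T s \<omega>) A k"

text \<open>What \<open>task_cov\<close> has become once \<open>i\<close> later projectors are
  averaged out.\<close>

definition cov_op :: "nat \<Rightarrow> 'd task \<Rightarrow> real^'d^'d"
  where "cov_op i \<tau> = (S_op \<mu> ^^ i) (task_cov \<tau>)"

lemma err_Suc: "err A (Suc k) \<omega> = null_proj (T (Suc k) \<omega>) ** err A k \<omega> ** null_proj (T (Suc k) \<omega>)"
  by (simp add: err_def)

lemma err_past: "err_mat (\<lambda>s\<in>{1..k}. T s \<omega>) A k = err A k \<omega>"
  unfolding err_def by (rule err_mat_cong) simp

lemma measurable_err [measurable]: "err A k \<in> borel_measurable M"
  unfolding err_def[abs_def] by (rule measurable_err_mat) (simp add: measurable_T)

lemma measurable_err_mat_past [measurable]: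
  "(\<lambda>x. err_mat (fst x) A k) \<in> borel_measurable (PiM {1..k} (\<lambda>_. task_space) \<Otimes>\<^sub>M task_space)"
  by (rule measurable_err_mat[where \<tau> = "\<lambda>s x. fst x s"])
    (auto intro: measurable_compose[OF measurable_fst] measurable_component_singleton)

lemma integrable_err: "integrable M (err A k)"
proof -
  obtain K where "\<And>\<tau> :: nat \<Rightarrow> 'd task. norm (err_mat \<tau> A k) \<le> K" using err_mat_bound by blast
  then show ?thesis by (intro integrable_const_bound[where B = K]) (auto simp: err_def)
qed

lemma integrable_cov_op: "integrable \<mu> (cov_op i)"
  unfolding cov_op_def[abs_def]
  by (rule integrable_bounded_linear[OF bounded_linear_S_op_power integrable_cov])

lemma measurable_cov_op [measurable]: "cov_op i \<in> borel_measurable task_space"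
  using borel_measurable_integrable[OF integrable_cov_op, of i]
  by (simp add: measurable_cong_sets[OF sets_mu refl])

lemma integrable_cov_op_err:
  assumes "t \<ge> 1"
  shows "integrable M (\<lambda>\<omega>. trace (cov_op i (T t \<omega>) ** err A k \<omega>))"
proof -
  obtain K where "\<And>\<tau> :: nat \<Rightarrow> 'd task. norm (err_mat \<tau> A k) \<le> K" using err_mat_bound by blast
  then show ?thesis
    using integrable_T[OF assms integrable_cov_op]
    by (intro integrable_trace_mult_bounded[where K = K]) (simp_all add: measurable_err, simp add: err_def)
qed

text \<open>The newest projector is the outermost. Averaging the past first puts the mean of
  \<open>err A k\<close> inside the sandwich by linearity; averaging the newest task then applies
  \<open>S_op\<close> once more.\<close>

lemma integral_err: "(\<integral>\<omega>. err A k \<omega> \<partial>M) = (S_op \<mu> ^^ k) A"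
proof (induction k)
  case 0
  then show ?case by (simp add: err_def prob_space)
next
  case (Suc k)
  let ?f = "\<lambda>x \<tau>. null_proj \<tau> ** err_mat x A k ** null_proj (\<tau> :: 'd task)"
  have f: "case_prod ?f \<in> borel_measurable (PiM {1..k} (\<lambda>_. task_space) \<Otimes>\<^sub>M task_space)"
    unfolding split_beta' by measurable
  have int: "integrable M (\<lambda>\<omega>. ?f (\<lambda>s\<in>{1..k}. T s \<omega>) (T (Suc k) \<omega>))"
    unfolding err_past err_Suc[symmetric] by (rule integrable_err)
  have "(\<integral>\<omega>. err A (Suc k) \<omega> \<partial>M) = (\<integral>\<tau>. (\<integral>\<omega>. null_proj \<tau> ** err A k \<omega> ** null_proj \<tau> \<partial>M) \<partial>\<mu>)"
    using integral_past_next(2)[OF f int] unfolding err_past err_Suc[symmetric] .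
  also have "\<dots> = S_op \<mu> (\<integral>\<omega>. err A k \<omega> \<partial>M)"
    unfolding S_op_def integral_bounded_linear[OF bounded_linear_sandwich integrable_err] ..
  finally show ?case by (simp add: Suc)
qed

text \<open>As \<open>t \<le> k\<close>, the matrix of task \<open>t\<close> belongs to the past.
  The newest task occurs only in the outer projectors, which cyclicity of the trace moves around
  \<open>cov_op\<close>, where their average is \<open>S_op\<close>.\<close>

lemma integral_cov_op_err_later:
  assumes "1 \<le> t" "t \<le> k"
  shows "(\<integral>\<omega>. trace (cov_op i (T t \<omega>) ** err A (Suc k) \<omega>) \<partial>M) =
    (\<integral>\<omega>. trace (cov_op (Suc i) (T t \<omega>) ** err A k \<omega>) \<partial>M)"
proof -
  let ?f = "\<lambda>x \<tau>. trace (cov_op i (x t) ** (null_proj \<tau> ** err_mat x A k ** null_proj (\<tau> :: 'd task)))"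
  have [measurable]: "(\<lambda>x. fst x t) \<in> (PiM {1..k} (\<lambda>_. task_space) \<Otimes>\<^sub>M task_space) \<rightarrow>\<^sub>M (task_space :: 'd task measure)"
    using assms by (auto intro: measurable_compose[OF measurable_fst] measurable_component_singleton)
  have f: "case_prod ?f \<in> borel_measurable (PiM {1..k} (\<lambda>_. task_space) \<Otimes>\<^sub>M task_space)"
    unfolding split_beta' by measurable
  have past: "(\<lambda>s\<in>{1..k}. T s \<omega>) t = T t \<omega>" for \<omega> using assms by simp
  have int: "integrable M (\<lambda>\<omega>. ?f (\<lambda>s\<in>{1..k}. T s \<omega>) (T (Suc k) \<omega>))"
    unfolding err_past err_Suc[symmetric] past by (rule integrable_cov_op_err) fact
  have move: "trace (D ** (P ** U ** P)) = trace ((P ** D ** P) ** U)" for D P U :: "real^'d^'d"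
    by (metis matrix_mul_assoc trace_mul_sym)
  have "bounded_linear (\<lambda>D. trace (D ** (U :: real^'d^'d)))" for U
    using bounded_linear_compose[OF bounded_linear_trace
        bounded_bilinear.bounded_linear_left[OF bounded_bilinear_matrix_mult]] .
  note lin = integral_bounded_linear[OF this]
  interpret Q: prob_space \<mu> by (rule prob_space_mu)
  have id: "(\<lambda>T. T) \<in> \<mu> \<rightarrow>\<^sub>M task_space" by measurable
  have intS: "integrable \<mu> (\<lambda>T. null_proj T ** B ** null_proj T)" for B :: "real^'d^'d"
    using integrable_sandwich_null_proj[OF id, of "\<lambda>_. B"] by simp
  have "(\<integral>\<omega>. trace (cov_op i (T t \<omega>) ** err A (Suc k) \<omega>) \<partial>M) =
    (\<integral>\<omega>. (\<integral>\<tau>. trace (cov_op i (T t \<omega>) ** (null_proj \<tau> ** err A k \<omega> ** null_proj \<tau>)) \<partial>\<mu>) \<partial>M)"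
    using integral_past_next(1)[OF f int] unfolding err_past past err_Suc[symmetric] .
  also have "\<dots> = (\<integral>\<omega>. trace (S_op \<mu> (cov_op i (T t \<omega>)) ** err A k \<omega>) \<partial>M)"
    unfolding move S_op_def lin[OF intS] ..
  finally show ?thesis by (simp add: cov_op_def)
qed

text \<open>Here \<open>cov_op\<close> and the outer projectors share the task \<open>Suc k\<close>
  and stay coupled; only the past inside the sandwich is averaged, by
  \<open>integral_err\<close>.\<close>

lemma integral_cov_op_err_current:
  "(\<integral>\<omega>. trace (cov_op i (T (Suc k) \<omega>) ** err A (Suc k) \<omega>) \<partial>M) =
    (\<integral>\<omega>. trace (cov_op i (T (Suc k) \<omega>) **
       (null_proj (T (Suc k) \<omega>) ** (S_op \<mu> ^^ k) A ** null_proj (T (Suc k) \<omega>))) \<partial>M)"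
proof -
  let ?f = "\<lambda>x \<tau>. trace (cov_op i \<tau> ** (null_proj \<tau> ** err_mat x A k ** null_proj (\<tau> :: 'd task)))"
  have f: "case_prod ?f \<in> borel_measurable (PiM {1..k} (\<lambda>_. task_space) \<Otimes>\<^sub>M task_space)"
    unfolding split_beta' by measurable
  have int: "integrable M (\<lambda>\<omega>. ?f (\<lambda>s\<in>{1..k}. T s \<omega>) (T (Suc k) \<omega>))"
    unfolding err_past err_Suc[symmetric] by (rule integrable_cov_op_err) simp
  have "bounded_linear (\<lambda>U. trace (D ** (P ** U ** P)))" for D P :: "real^'d^'d"
    using bounded_linear_compose[OF bounded_linear_trace
        bounded_linear_compose[OF bounded_bilinear.bounded_linear_right[OF bounded_bilinear_matrix_mult]
          bounded_linear_sandwich]] .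
  note lin = integral_bounded_linear[OF this integrable_err]
  have "(\<integral>\<omega>. trace (cov_op i (T (Suc k) \<omega>) ** err A (Suc k) \<omega>) \<partial>M) =
    (\<integral>\<tau>. (\<integral>\<omega>. trace (cov_op i \<tau> ** (null_proj \<tau> ** err A k \<omega> ** null_proj \<tau>)) \<partial>M) \<partial>\<mu>)"
    using integral_past_next(2)[OF f int] unfolding err_past err_Suc[symmetric] .
  also have "\<dots> = (\<integral>\<tau>. trace (cov_op i \<tau> ** (null_proj \<tau> ** (S_op \<mu> ^^ k) A ** null_proj \<tau>)) \<partial>\<mu>)"
    unfolding lin integral_err ..
  finally show ?thesis
    by (subst integral_T) simp_all
qed

lemma integral_cov_err:
  assumes "1 \<le> t" "t \<le> k"
  shows "(\<integral>\<omega>. trace (task_cov (T t \<omega>) ** err A k \<omega>) \<partial>M) =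
    (\<integral>\<omega>. trace ((S_op \<mu> ^^ (k - t)) (task_cov (T t \<omega>)) ** null_proj (T t \<omega>) **
       (S_op \<mu> ^^ (t - 1)) A ** null_proj (T t \<omega>)) \<partial>M)"
proof -
  \<comment> \<open>Peeling \<open>m\<close> later tasks moves \<open>m\<close> from the error index
    to the power of \<open>S_op\<close>; \<open>i\<close> is arbitrary because the induction
    hypothesis is used at \<open>Suc i\<close>.\<close>
  have shift: "(\<integral>\<omega>. trace (cov_op i (T t \<omega>) ** err A (t + m) \<omega>) \<partial>M) =
      (\<integral>\<omega>. trace (cov_op (i + m) (T t \<omega>) ** err A t \<omega>) \<partial>M)" for i m
  proof (induction m arbitrary: i)
    case (Suc m)
    then show ?case
      using integral_cov_op_err_later[of t "t + m" i A] Suc.IH[of "Suc i"] assms(1) by simp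
  qed simp
  \<comment> \<open>The \<open>s = t - 1\<close> tasks before task \<open>t\<close> give the power
    of \<open>S_op\<close> applied to \<open>A\<close>.\<close>
  obtain s where s: "t = Suc s" using assms(1) by (cases t) auto
  show ?thesis
    using shift[of 0 "k - t"] integral_cov_op_err_current[of "k - t" s A] assms
    by (simp add: s cov_op_def matrix_mul_assoc)
qed

section \<open>Assembling the forgetting\<close>

lemma forgetting_eq:
  assumes fits: "AE \<tau> in \<mu>. fits \<tau> w" and k: "k \<ge> 1"
  shows "forgetting M T k = (1 / real k) * (\<Sum>t=1..k-1.
    (\<integral>\<omega>. trace ((S_op \<mu> ^^ (k - t)) (task_cov (T t \<omega>)) ** null_proj (T t \<omega>) **
       (S_op \<mu> ^^ (t - 1)) (outer w w) ** null_proj (T t \<omega>)) \<partial>M))"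
proof -
  let ?E = "err (outer w w) k"
  have int: "integrable M (\<lambda>\<omega>. trace (task_cov (T t \<omega>) ** ?E \<omega>))" if "t \<in> {1..k}" for t
    using integrable_cov_op_err[of t 0] that by (simp add: cov_op_def)
  have AE1: "AE \<omega> in M. fits (T t \<omega>) w" if "t \<in> {1..k}" for t
    using AE_distrD[OF measurable_T, of t] fits distr_T[of t] that by auto
  \<comment> \<open>Finitely many null sets, one for each task up to \<open>k\<close>, are discarded
    together.\<close>
  have "AE \<omega> in M. \<forall>t\<in>{1..k}. fits (T t \<omega>) w"
    using AE1 by (intro AE_finite_allI) auto
  then have AE: "AE \<omega> in M. (1 / real k) * (\<Sum>t=1..k. loss (T t \<omega>) (iterate (\<lambda>s. T s \<omega>) k)) =
    (1 / real k) * (\<Sum>t=1..k. trace (task_cov (T t \<omega>) ** ?E \<omega>))"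
  proof eventually_elim
    case (elim \<omega>)
    then have "outer (iterate (\<lambda>s. T s \<omega>) k - w) (iterate (\<lambda>s. T s \<omega>) k - w) = ?E \<omega>"
      unfolding err_def by (intro outer_iterate_error) auto
    then show ?case
      using elim by (intro arg_cong2[where f = "(*)"] sum.cong refl) (simp add: loss_eq_trace[of _ w])
  qed
  have "forgetting M T k = (\<integral>\<omega>. (1 / real k) * (\<Sum>t=1..k. trace (task_cov (T t \<omega>) ** ?E \<omega>)) \<partial>M)"
    unfolding forgetting_def
  \<comment> \<open>The rule asks for measurability of both integrands, for the losses also on the
    null event of inconsistent tasks.\<close>
  proof (rule integral_cong_AE[OF _ _ AE])
    have "(\<lambda>\<omega>. loss (T t \<omega>) (iterate (\<lambda>s. T s \<omega>) k)) \<in> borel_measurable M" if "t \<in> {1..k}" for t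
      using that by (intro measurable_loss measurable_iterate measurable_T) auto
    then show "(\<lambda>\<omega>. (1 / real k) * (\<Sum>t=1..k. loss (T t \<omega>) (iterate (\<lambda>s. T s \<omega>) k)))
      \<in> borel_measurable M" by measurable
    show "(\<lambda>\<omega>. (1 / real k) * (\<Sum>t=1..k. trace (task_cov (T t \<omega>) ** ?E \<omega>))) \<in> borel_measurable M"
      using borel_measurable_integrable[OF int] by measurable
  qed
  also have "\<dots> = (1 / real k) * (\<Sum>t=1..k. \<integral>\<omega>. trace (task_cov (T t \<omega>) ** ?E \<omega>) \<partial>M)"
    using int by simp
  also have "(\<Sum>t=1..k. \<integral>\<omega>. trace (task_cov (T t \<omega>) ** ?E \<omega>) \<partial>M) =
    (\<Sum>t=1..k-1. \<integral>\<omega>. trace (task_cov (T t \<omega>) ** ?E \<omega>) \<partial>M)"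
  proof -
    obtain j where j: "k = Suc j" using k by (cases k) auto
    \<comment> \<open>The last task is fitted exactly: its covariance meets its own projector at the
      left end of the sandwich, so the sum stops at \<open>k - 1\<close>.\<close>
    have "trace (task_cov (T k \<omega>) ** ?E \<omega>) = 0" for \<omega>
      by (simp add: j err_Suc matrix_mul_assoc) (simp add: trace_def)
    then show ?thesis by (simp add: j)
  qed
  also have "\<dots> = (\<Sum>t=1..k-1.
    (\<integral>\<omega>. trace ((S_op \<mu> ^^ (k - t)) (task_cov (T t \<omega>)) ** null_proj (T t \<omega>) **
       (S_op \<mu> ^^ (t - 1)) (outer w w) ** null_proj (T t \<omega>)) \<partial>M))"
    by (intro sum.cong refl integral_cov_err) auto
  finally show ?thesis .
qed

end

theorem theorem3p1:
  fixes M :: "'w measure"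
    and \<mu> :: "'d::finite task measure"
    and T :: "nat \<Rightarrow> 'w \<Rightarrow> 'd task"
    and wstar :: "real^'d"
  assumes "prob_space \<mu>" and "sets \<mu> = sets task_space"
    and "prob_space M"
    and "prob_space.indep_vars M (\<lambda>_. task_space) T {1..}"
    and "\<And>t. t \<ge> 1 \<Longrightarrow> distr M task_space (T t) = \<mu>"
    and common_solution: "AE \<tau> in \<mu>. fits \<tau> wstar"
    and "integrable \<mu> (\<lambda>\<tau>. norm (task_cov \<tau>))"
  shows "(\<forall>A t. transpose A = A \<longrightarrow> t \<ge> 1 \<longrightarrow>
            (\<integral>\<omega>. null_proj (T t \<omega>) ** A ** null_proj (T t \<omega>) \<partial>M) = S_op \<mu> A) \<and>
         (\<forall>k\<ge>2. forgetting M T k =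
            (1 / real k) * (\<Sum>t=1..k-1.
               (\<integral>\<omega>. trace ((S_op \<mu> ^^ (k - t)) (task_cov (T t \<omega>)) ** null_proj (T t \<omega>) **
                          (S_op \<mu> ^^ (t - 1)) (outer wstar wstar) ** null_proj (T t \<omega>)) \<partial>M)))"
proof -
  interpret prob_space M by fact
  \<comment> \<open>The moment hypothesis concerns the norm; measurability turns it into Bochner
    integrability of the matrix.\<close>
  have "task_cov \<in> borel_measurable \<mu>"
    using measurable_task_cov by (simp add: measurable_cong_sets[OF assms(2) refl])
  then have "integrable \<mu> task_cov"
    using assms(7) by (simp add: integrable_norm_iff)
  then interpret iid_tasks M \<mu> T
    using assms(4,5) by unfold_locales
  show ?thesis
    using S_op_eq forgetting_eq[OF common_solution] by auto
qed

end
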